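(* For every finite set $\Gamma$ of formulas and all finite multisets $\Delta_1,\Delta_2$ of formulas: $(\Gamma;\Delta_1)\preceq_l(\Gamma;\Delta_2)$ if and only if $(\Gamma;\Delta_1)\preceq_s(\Gamma;\Delta_2)$.
   Context: Formulas: $A,B,C ::= a \mid \mathbf{1} \mid A\otimes B \mid \top \mid A \,\&\, B \mid a \multimap B \mid\ !A$, with $a$ ranging over atomic formulas. Contexts $\Gamma,\Delta$ are finite multisets of formulas; "$\Delta_1,\Delta_2$" is multiset union, "$\cdot$" the empty context. Sequents $\Gamma;\Delta\vdash A$ are derivable by the rules: (init) $\Gamma;a\vdash a$. (clone) from $\Gamma,A;\Delta,A\vdash C$ infer $\Gamma,A;\Delta\vdash C$. ($\otimes$R) from $\Gamma;\Delta_1\vdash A$ and $\Gamma;\Delta_2\vdash B$ infer $\Gamma;\Delta_1,\Delta_2\vdash A\otimes B$. ($\otimes$L) from $\Gamma;\Delta,A,B\vdash C$ infer $\Gamma;\Delta,A\otimes B\vdash C$. ($\mathbf 1$R) $\Gamma;\cdot\vdash\mathbf 1$. ($\mathbf 1$L) from $\Gamma;\Delta\vdash C$ infer $\Gamma;\Delta,\mathbf 1\vdash C$. ($\&$R) from $\Gamma;\Delta\vdash A$ and $\Gamma;\Delta\vdash B$ infer $\Gamma;\Delta\vdash A\&B$. ($\&$L$_i$, $i=1,2$) from $\Gamma;\Delta,A_i\vdash C$ infer $\Gamma;\Delta,A_1\&A_2\vdash C$. ($\top$R) $\Gamma;\Delta\vdash\top$ (no left rule for $\top$). ($\multimap$R)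 from $\Gamma;\Delta,a\vdash B$ infer $\Gamma;\Delta\vdash a\multimap B$. ($\multimap$L) from $\Gamma;\Delta_1\vdash a$ and $\Gamma;\Delta_2,B\vdash C$ infer $\Gamma;\Delta_1,\Delta_2,a\multimap B\vdash C$. (!R) from $\Gamma;\cdot\vdash A$ infer $\Gamma;\cdot\vdash\,!A$. (!L) from $\Gamma,A;\Delta\vdash C$ infer $\Gamma;\Delta,!A\vdash C$. Logical preorder: $(\Gamma_1;\Delta_1)\preceq_l(\Gamma_2;\Delta_2)$ iff for all contexts $\Gamma',\Delta'$ and all formulas $C$, derivability of $\Gamma',\Gamma_1;\Delta',\Delta_1\vdash C$ implies derivability of $\Gamma',\Gamma_2;\Delta',\Delta_2\vdash C$. States are pairs $(\Gamma;\Delta)$ modulo structural congruence $\equiv$: $\Delta$ is a multiset and $\Gamma$ a set ($(\Gamma,A,A;\Delta)\equiv(\Gamma,A;\Delta)$); congruent states are identified. Composition: $((\Gamma_1;\Delta_1),(\Gamma_2;\Delta_2)) := (\Gamma_1,\Gamma_2;\Delta_1,\Delta_2)$. Labelled transitions with labels $\tau$, $!a$, $?a$ ($a$ atomic) are generated by: $(\Gamma;\Delta,a)\xrightarrow{!a}(\Gamma;\Delta)$; $(\Gamma;\Delta,a\multimap B)\xrightarrow{?a}(\Gamma;\Delta,B)$; if $S_1\xrightarrow{!a}S_1'$ and $S_2\xrightarrow{?a}S_2'$ then $(S_1,S_2)\xrightarrow{\tau}(S_1',S_2')$; $(\Gamma;\Delta,A\otimes B)\xrightarrow{\tau}(\Gamma;\Delta,A,B)$;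 $(\Gamma;\Delta,\mathbf 1)\xrightarrow{\tau}(\Gamma;\Delta)$; $(\Gamma;\Delta,A_1\&A_2)\xrightarrow{\tau}(\Gamma;\Delta,A_i)$; $(\Gamma;\Delta,!A)\xrightarrow{\tau}(\Gamma,A;\Delta)$; $(\Gamma,A;\Delta)\xrightarrow{\tau}(\Gamma,A;\Delta,A)$ (no rule for $\top$). $\alpha$ ranges over $\tau$ and $!a$. $\overset{\tau}{\Longrightarrow}$ is the reflexive transitive closure of $\xrightarrow{\tau}$; for $\beta\ne\tau$, $\overset{\beta}{\Longrightarrow}$ is $\overset{\tau}{\Longrightarrow}\xrightarrow{\beta}\overset{\tau}{\Longrightarrow}$. A relation $\mathcal R$ on states is a simulation if $(\Gamma_1;\Delta_1)\mathcal R(\Gamma_2;\Delta_2)$ implies: (1) if $(\Gamma_1;\Delta_1)\equiv(\Gamma_1';\cdot)$ then $(\Gamma_2;\Delta_2)\overset{\tau}{\Longrightarrow}(\Gamma_2';\cdot)$ with $(\Gamma_1';\cdot)\mathcal R(\Gamma_2';\cdot)$; (2) if $(\Gamma_1;\Delta_1)\equiv((\Gamma_1';\Delta_1'),(\Gamma_1'';\Delta_1''))$ then $(\Gamma_2;\Delta_2)\overset{\tau}{\Longrightarrow}((\Gamma_2';\Delta_2'),(\Gamma_2'';\Delta_2''))$ with $(\Gamma_1';\Delta_1')\mathcal R(\Gamma_2';\Delta_2')$ and $(\Gamma_1'';\Delta_1'')\mathcal R(\Gamma_2'';\Delta_2'')$; (3) if $(\Gamma_1;\Delta_1)\xrightarrow{\alpha}(\Gamma_1';\Delta_1')$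 then $(\Gamma_2;\Delta_2)\overset{\alpha}{\Longrightarrow}(\Gamma_2';\Delta_2')$ with $(\Gamma_1';\Delta_1')\mathcal R(\Gamma_2';\Delta_2')$; (4) if $(\Gamma_1;\Delta_1)\xrightarrow{?a}(\Gamma_1';\Delta_1')$ then $(\Gamma_2;\Delta_2,a)\overset{\tau}{\Longrightarrow}(\Gamma_2';\Delta_2')$ with $(\Gamma_1';\Delta_1')\mathcal R(\Gamma_2';\Delta_2')$. $S_1\preceq_s S_2$ iff some simulation relates $S_1$ to $S_2$. *)

theory Defs
  imports "HOL-Library.Multiset" "HOL-Library.FSet"
begin

datatype 'a form =
    Atom 'a
  | Unit
  | Tensor "'a form" "'a form"
  | Top
  | With "'a form" "'a form"
  | Lolli 'a "'a form"
  | Bang "'a form"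

inductive derivable :: "'a form multiset \<Rightarrow> 'a form multiset \<Rightarrow> 'a form \<Rightarrow> bool" where
  init: "derivable \<Gamma> {#Atom a#} (Atom a)"
| clone: "derivable (add_mset A \<Gamma>) (add_mset A \<Delta>) C \<Longrightarrow> derivable (add_mset A \<Gamma>) \<Delta> C"
| tensorR: "derivable \<Gamma> \<Delta>\<^sub>1 A \<Longrightarrow> derivable \<Gamma> \<Delta>\<^sub>2 B \<Longrightarrow> derivable \<Gamma> (\<Delta>\<^sub>1 + \<Delta>\<^sub>2) (Tensor A B)"
| tensorL: "derivable \<Gamma> (add_mset A (add_mset B \<Delta>)) C \<Longrightarrow> derivable \<Gamma> (add_mset (Tensor A B) \<Delta>) C"
| unitR: "derivable \<Gamma> {#} Unit"
| unitL: "derivable \<Gamma> \<Delta> C \<Longrightarrow> derivable \<Gamma> (add_mset Unit \<Delta>) C"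
| withR: "derivable \<Gamma> \<Delta> A \<Longrightarrow> derivable \<Gamma> \<Delta> B \<Longrightarrow> derivable \<Gamma> \<Delta> (With A B)"
| withL1: "derivable \<Gamma> (add_mset A \<Delta>) C \<Longrightarrow> derivable \<Gamma> (add_mset (With A B) \<Delta>) C"
| withL2: "derivable \<Gamma> (add_mset B \<Delta>) C \<Longrightarrow> derivable \<Gamma> (add_mset (With A B) \<Delta>) C"
| topR: "derivable \<Gamma> \<Delta> Top"
| lolliR: "derivable \<Gamma> (add_mset (Atom a) \<Delta>) B \<Longrightarrow> derivable \<Gamma> \<Delta> (Lolli a B)"
| lolliL: "derivable \<Gamma> \<Delta>\<^sub>1 (Atom a) \<Longrightarrow> derivable \<Gamma> (add_mset B \<Delta>\<^sub>2) C \<Longrightarrow>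
    derivable \<Gamma> (add_mset (Lolli a B) (\<Delta>\<^sub>1 + \<Delta>\<^sub>2)) C"
| bangR: "derivable \<Gamma> {#} A \<Longrightarrow> derivable \<Gamma> {#} (Bang A)"
| bangL: "derivable (add_mset A \<Gamma>) \<Delta> C \<Longrightarrow> derivable \<Gamma> (add_mset (Bang A) \<Delta>) C"

definition logical_preorder ::
  "'a form multiset \<times> 'a form multiset \<Rightarrow> 'a form multiset \<times> 'a form multiset \<Rightarrow> bool"
  (infix "\<preceq>\<^sub>l" 50) where
  "S\<^sub>1 \<preceq>\<^sub>l S\<^sub>2 \<longleftrightarrow>
    (\<forall>\<Gamma>' \<Delta>' C. derivable (\<Gamma>' + fst S\<^sub>1) (\<Delta>' + snd S\<^sub>1) C \<longrightarrow>
                derivable (\<Gamma>' + fst S\<^sub>2) (\<Delta>' + snd S\<^sub>2) C)"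

text \<open>
  States are taken modulo structural congruence: the unrestricted part is a finite set and the
  linear part a multiset, so congruence of states is equality.
\<close>

type_synonym 'a state = "'a form fset \<times> 'a form multiset"

definition compose :: "'a state \<Rightarrow> 'a state \<Rightarrow> 'a state" where
  "compose S\<^sub>1 S\<^sub>2 = (fst S\<^sub>1 |\<union>| fst S\<^sub>2, snd S\<^sub>1 + snd S\<^sub>2)"

datatype 'a label = Tau | Out 'a | In 'a

inductive step :: "'a state \<Rightarrow> 'a label \<Rightarrow> 'a state \<Rightarrow> bool" where
  out: "step (\<Gamma>, add_mset (Atom a) \<Delta>) (Out a) (\<Gamma>, \<Delta>)"
| inp: "step (\<Gamma>, add_mset (Lolli a B) \<Delta>) (In a) (\<Gamma>, add_mset B \<Delta>)"
| comm: "step S\<^sub>1 (Out a) S\<^sub>1' \<Longrightarrow> step S\<^sub>2 (In a) S\<^sub>2' \<Longrightarrow>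
    step (compose S\<^sub>1 S\<^sub>2) Tau (compose S\<^sub>1' S\<^sub>2')"
| tensor: "step (\<Gamma>, add_mset (Tensor A B) \<Delta>) Tau (\<Gamma>, add_mset A (add_mset B \<Delta>))"
| unit: "step (\<Gamma>, add_mset Unit \<Delta>) Tau (\<Gamma>, \<Delta>)"
| with1: "step (\<Gamma>, add_mset (With A B) \<Delta>) Tau (\<Gamma>, add_mset A \<Delta>)"
| with2: "step (\<Gamma>, add_mset (With A B) \<Delta>) Tau (\<Gamma>, add_mset B \<Delta>)"
| bang: "step (\<Gamma>, add_mset (Bang A) \<Delta>) Tau (finsert A \<Gamma>, \<Delta>)"
| clone: "step (finsert A \<Gamma>, \<Delta>) Tau (finsert A \<Gamma>, add_mset A \<Delta>)"

definition tau_steps :: "'a state \<Rightarrow> 'a state \<Rightarrow> bool" where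
  "tau_steps = (\<lambda>S S'. step S Tau S')\<^sup>*\<^sup>*"

definition weak_step :: "'a state \<Rightarrow> 'a label \<Rightarrow> 'a state \<Rightarrow> bool" where
  "weak_step S \<beta> S' \<longleftrightarrow>
    (if \<beta> = Tau then tau_steps S S'
     else \<exists>T T'. tau_steps S T \<and> step T \<beta> T' \<and> tau_steps T' S')"

definition simulation :: "('a state \<Rightarrow> 'a state \<Rightarrow> bool) \<Rightarrow> bool" where
  "simulation R \<longleftrightarrow> (\<forall>S\<^sub>1 S\<^sub>2. R S\<^sub>1 S\<^sub>2 \<longrightarrow>
    (\<forall>\<Gamma>\<^sub>1'. S\<^sub>1 = (\<Gamma>\<^sub>1', {#}) \<longrightarrow>
      (\<exists>\<Gamma>\<^sub>2'. weak_step S\<^sub>2 Tau (\<Gamma>\<^sub>2', {#}) \<and> R (\<Gamma>\<^sub>1', {#}) (\<Gamma>\<^sub>2', {#}))) \<and>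
    (\<forall>S\<^sub>1' S\<^sub>1''. S\<^sub>1 = compose S\<^sub>1' S\<^sub>1'' \<longrightarrow>
      (\<exists>S\<^sub>2' S\<^sub>2''. weak_step S\<^sub>2 Tau (compose S\<^sub>2' S\<^sub>2'') \<and> R S\<^sub>1' S\<^sub>2' \<and> R S\<^sub>1'' S\<^sub>2'')) \<and>
    (\<forall>\<alpha> S\<^sub>1'. (\<alpha> = Tau \<or> (\<exists>a. \<alpha> = Out a)) \<and> step S\<^sub>1 \<alpha> S\<^sub>1' \<longrightarrow>
      (\<exists>S\<^sub>2'. weak_step S\<^sub>2 \<alpha> S\<^sub>2' \<and> R S\<^sub>1' S\<^sub>2')) \<and>
    (\<forall>a S\<^sub>1'. step S\<^sub>1 (In a) S\<^sub>1' \<longrightarrow>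
      (\<exists>S\<^sub>2'. weak_step (fst S\<^sub>2, add_mset (Atom a) (snd S\<^sub>2)) Tau S\<^sub>2' \<and> R S\<^sub>1' S\<^sub>2')))"

definition sim_preorder :: "'a state \<Rightarrow> 'a state \<Rightarrow> bool" (infix "\<preceq>\<^sub>s" 50) where
  "S\<^sub>1 \<preceq>\<^sub>s S\<^sub>2 \<longleftrightarrow> (\<exists>R. simulation R \<and> R S\<^sub>1 S\<^sub>2)"

end

theory Submission imports Defs begin

text \<open>
  No cut elimination is needed. A sequent with an atomic, \<open>\<one>\<close>, \<open>\<otimes>\<close> or \<open>!\<close> succedent is derivable iff
  its context can reach, by silent steps, a state to which the right rule applies
  (\<open>entails_focus\<close>). Say that a state \<open>(G; D)\<close> realises \<open>(\<Gamma>; A\<^sub>1, \<dots>, A\<^sub>n)\<close> if \<open>G\<close> proves each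
  formula of \<open>\<Gamma>\<close> and \<open>D\<close> splits into parts proving \<open>A\<^sub>1, \<dots>, A\<^sub>n\<close>. Relating \<open>S\<^sub>1\<close> to \<open>S\<^sub>2\<close> when \<open>S\<^sub>2\<close>
  silently reaches a state realising \<open>S\<^sub>1\<close> gives a simulation. Each state has a characteristic formula
  (the tensor of its linear formulas and its banged unrestricted ones) which it proves, and any
  state proving that formula reaches a realising state; hence the logical preorder is contained
  in similarity. Conversely, similarity is a precongruence for composition and, by induction on
  derivations, preserves derivability.
\<close>

subsection \<open>The sequent calculus with a set of unrestricted formulas\<close>

text \<open>States carry a finite set of unrestricted formulas, so sequents are recast over sets in
  order to share contexts with states; contraction is then invisible.\<close>

inductive entails :: "'a form fset \<Rightarrow> 'a form multiset \<Rightarrow> 'a form \<Rightarrow> bool" where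
  init: "entails G {#Atom a#} (Atom a)"
| clone: "A |\<in>| G \<Longrightarrow> entails G (add_mset A D) C \<Longrightarrow> entails G D C"
| tensorR: "entails G D A \<Longrightarrow> entails G E B \<Longrightarrow> entails G (D + E) (Tensor A B)"
| tensorL: "entails G (add_mset A (add_mset B D)) C \<Longrightarrow> entails G (add_mset (Tensor A B) D) C"
| unitR: "entails G {#} Unit"
| unitL: "entails G D C \<Longrightarrow> entails G (add_mset Unit D) C"
| withR: "entails G D A \<Longrightarrow> entails G D B \<Longrightarrow> entails G D (With A B)"
| withL1: "entails G (add_mset A D) C \<Longrightarrow> entails G (add_mset (With A B) D) C"
| withL2: "entails G (add_mset B D) C \<Longrightarrow> entails G (add_mset (With A B) D) C"
| topR: "entails G D Top"
| lolliR: "entails G (add_mset (Atom a) D) B \<Longrightarrow> entails G D (Lolli a B)"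
| lolliL: "entails G D (Atom a) \<Longrightarrow> entails G (add_mset B E) C \<Longrightarrow>
    entails G (add_mset (Lolli a B) (D + E)) C"
| bangR: "entails G {#} A \<Longrightarrow> entails G {#} (Bang A)"
| bangL: "entails (finsert A G) D C \<Longrightarrow> entails G (add_mset (Bang A) D) C"

text \<open>\<open>clone\<close> is left out because it applies to every goal and makes proof search loop.\<close>

lemmas entails_rules = entails.init entails.tensorR entails.tensorL entails.unitR entails.unitL entails.withR
  entails.withL1 entails.withL2 entails.topR entails.lolliR entails.lolliL entails.bangR entails.bangL

lemmas derivable_rules = derivable.init derivable.tensorR derivable.tensorL derivable.unitR derivable.unitL derivable.withR
  derivable.withL1 derivable.withL2 derivable.topR derivable.lolliR derivable.lolliL derivable.bangR derivable.bangL

text \<open>Inclusion in place of equality makes the induction absorb weakening. Multiplicities in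
  \<Gamma> do not matter because \<open>clone\<close> keeps the formula that it copies.\<close>

lemma derivable_imp_entails:
  "derivable \<Gamma> D C \<Longrightarrow> set_mset \<Gamma> \<subseteq> fset G \<Longrightarrow> entails G D C"
proof (induction arbitrary: G rule: derivable.induct)
  case (clone A \<Gamma> \<Delta> C)
  show ?case by (rule entails.clone[of A]) (use clone in auto)
next
  case (bangL A \<Gamma> \<Delta> C)
  then show ?case by (intro entails.bangL) auto
qed (auto intro: entails_rules)

lemma entails_imp_derivable:
  "entails G D C \<Longrightarrow> fset G \<subseteq> set_mset \<Gamma> \<Longrightarrow> derivable \<Gamma> D C"
proof (induction arbitrary: \<Gamma> rule: entails.induct)
  case (clone A G D C)
  then obtain \<Gamma>' where "\<Gamma> = add_mset A \<Gamma>'"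
    by (meson mset_add subsetD)
  then show ?case
    using clone.IH[OF clone.prems] by (simp add: derivable.clone)
next
  case (bangL A G D C)
  have "derivable (add_mset A \<Gamma>) D C"
    using bangL.prems by (intro bangL.IH) auto
  then show ?case by (rule derivable.bangL)
qed (auto intro: derivable_rules)

lemma derivable_iff_entails:
  assumes "set_mset \<Gamma> = fset G"
  shows "derivable \<Gamma> D C \<longleftrightarrow> entails G D C"
  using assms derivable_imp_entails entails_imp_derivable by (metis subset_refl)

text \<open>Both translations let the unrestricted zone grow, so a round trip through
  \<open>derivable\<close> gives weakening.\<close>

lemma entails_mono:
  assumes "entails G D C" "G |\<subseteq>| H"
  shows "entails H D C"
proof -
  have "derivable (mset_set (fset H)) D C"
    using assms by (intro entails_imp_derivable) (auto simp: less_eq_fset.rep_eq)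
  then show ?thesis
    by (rule derivable_imp_entails) simp
qed

lemma entails_union:
  assumes "entails G D C"
  shows "entails (G |\<union>| H) D C" "entails (H |\<union>| G) D C"
  using assms by (auto elim: entails_mono)

text \<open>\<open>G\<close> stays arbitrary because the \<open>Bang\<close> case moves
  \<open>A\<close> into the unrestricted zone before cloning it. Atomic antecedents let
  \<open>init\<close> close the left premise in the \<open>Lolli\<close> case.\<close>

lemma entails_identity: "entails G {#A#} A"
proof (induction A arbitrary: G)
  case (Tensor A B)
  have "entails G ({#A#} + {#B#}) (Tensor A B)"
    by (intro entails.tensorR Tensor)
  then show ?case
    by (intro entails.tensorL) (simp add: add_mset_commute)
next
  case (Lolli a B)
  have "entails G (add_mset (Lolli a B) ({#Atom a#} + {#})) B"
    by (intro entails.lolliL entails.init) (simp add: Lolli)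
  then show ?case
    by (intro entails.lolliR) (simp add: add_mset_commute)
next
  case (Bang A)
  have "entails (finsert A G) {#} A"
    by (rule entails.clone[of A]) (auto intro: Bang)
  then show ?case
    by (intro entails.bangL entails.bangR)
next
  case (With A B)
  then show ?case by (intro entails.withR) (auto intro: entails.withL1 entails.withL2)
qed (auto intro: entails.init entails.topR entails.unitR entails.unitL)

text \<open>A proof of \<open>With A B\<close> ends in \<open>withR\<close>, a left rule or
  \<open>clone\<close>, and the latter two commute with projection to either component.\<close>

lemma entails_with_inv:
  assumes "entails G D (With A B)"
  shows "entails G D A" "entails G D B"
proof -
  have "entails G D A \<and> entails G D B"
    using assms
  proof (induction G D "With A B" rule: entails.induct)
    case (clone A' G D)
    then show ?case using entails.clone[of A' G D] by blast
  qed (auto intro: entails_rules)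
  then show "entails G D A" "entails G D B" by auto
qed

text \<open>The extra atom is carried upwards through the left rules and \<open>clone\<close> until
  \<open>lolliR\<close> introduces it anyway.\<close>

lemma entails_lolli_inv:
  assumes "entails G D (Lolli a B)"
  shows "entails G (add_mset (Atom a) D) B"
  using assms
proof (induction G D "Lolli a B" rule: entails.induct)
  case (clone A G D)
  show ?case by (rule entails.clone[of A]) (use clone in \<open>auto simp: add_mset_commute\<close>)
next
  case (tensorL G A B' D)
  then have "entails G (add_mset (Tensor A B') (add_mset (Atom a) D)) B"
    by (intro entails.tensorL) (simp add: add_mset_commute)
  then show ?case by (simp add: add_mset_commute)
next
  case (unitL G D)
  then have "entails G (add_mset Unit (add_mset (Atom a) D)) B"
    by (intro entails.unitL)
  then show ?case by (simp add: add_mset_commute)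
next
  case (withL1 G A D B')
  then have "entails G (add_mset (With A B') (add_mset (Atom a) D)) B"
    by (intro entails.withL1) (simp add: add_mset_commute)
  then show ?case by (simp add: add_mset_commute)
next
  case (withL2 G B' D A)
  then have "entails G (add_mset (With A B') (add_mset (Atom a) D)) B"
    by (intro entails.withL2) (simp add: add_mset_commute)
  then show ?case by (simp add: add_mset_commute)
next
  case (lolliL G D b B' E)
  \<comment> \<open>The atom joins the right premise, the one whose succedent is the implication
    being inverted.\<close>
  then have "entails G (add_mset (Lolli b B') (D + add_mset (Atom a) E)) B"
    by (intro entails.lolliL) (simp_all add: add_mset_commute)
  then show ?case by (simp add: add_mset_commute)
next
  case (bangL A G D)
  then have "entails G (add_mset (Bang A) (add_mset (Atom a) D)) B"
    by (intro entails.bangL)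
  then show ?case by (simp add: add_mset_commute)
qed

subsection \<open>Silent steps and derivability\<close>

lemma step_Out_iff:
  "step (G, D) (Out a) S \<longleftrightarrow> (\<exists>E. D = add_mset (Atom a) E \<and> S = (G, E))"
  by (auto intro: step.out step.inp) (erule step.cases; auto)

lemma step_In_iff:
  "step (G, D) (In a) S \<longleftrightarrow> (\<exists>B E. D = add_mset (Lolli a B) E \<and> S = (G, add_mset B E))"
  by (auto intro: step.out step.inp) (erule step.cases; auto)

text \<open>The state is split into the lone atom and the rest, each keeping all of
  \<open>G\<close>, so that composing them restores \<open>G\<close>.\<close>

lemma step_comm:
  "step (G, add_mset (Atom a) (add_mset (Lolli a B) D)) Tau (G, add_mset B D)"
  using step.comm[OF step.out[of G a "{#}"] step.inp[of G a B D]]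
  by (simp add: compose_def add_mset_commute)

lemma step_clone: "A |\<in>| G \<Longrightarrow> step (G, D) Tau (G, add_mset A D)"
  using step.clone[of A G D] by (simp add: finsert_absorb)

text \<open>In the \<open>comm\<close> case both partners are located in one multiset, which removes
  the hidden composition from later case analyses.\<close>

lemma step_Tau_cases [consumes 1, case_names comm tensor unit with1 with2 bang clone]:
  assumes "step (G, D) Tau S"
  obtains a B E where "D = add_mset (Atom a) (add_mset (Lolli a B) E)" "S = (G, add_mset B E)"
  | A B E where "D = add_mset (Tensor A B) E" "S = (G, add_mset A (add_mset B E))"
  | E where "D = add_mset Unit E" "S = (G, E)"
  | A B E where "D = add_mset (With A B) E" "S = (G, add_mset A E)"
  | A B E where "D = add_mset (With A B) E" "S = (G, add_mset B E)"
  | A E where "D = add_mset (Bang A) E" "S = (finsert A G, E)"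
  | A where "A |\<in>| G" "S = (G, add_mset A D)"
  using assms
proof cases
  case (comm S1 a S1' S2 S2')
  then obtain G1 G2 D1 D2 B where
    "S1 = (G1, add_mset (Atom a) D1)" "S1' = (G1, D1)"
    "S2 = (G2, add_mset (Lolli a B) D2)" "S2' = (G2, add_mset B D2)"
    by (metis step_In_iff step_Out_iff surj_pair)
  with comm show ?thesis
    by (intro that(1)[of a B "D1 + D2"]) (auto simp: compose_def)
next
  case (clone A \<Gamma>)
  then show ?thesis by (intro that(7)[of A]) auto
next
  case (tensor A B E)
  then show ?thesis by (intro that(2)) auto
next
  case (unit E)
  then show ?thesis by (intro that(3)) auto
next
  case (with1 A B E)
  then show ?thesis by (intro that(4)) auto
next
  case (with2 A B E)
  then show ?thesis by (intro that(5)) auto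
next
  case (bang A E)
  then show ?thesis by (intro that(6)) auto
qed

lemma step_Tau_frame:
  assumes "step (G, D) Tau (G', D')"
  shows "step (G |\<union>| H, D + E) Tau (G' |\<union>| H, D' + E)"
  using assms
proof (cases rule: step_Tau_cases)
  case (clone A)
  then show ?thesis using step_clone[of A "G |\<union>| H" "D + E"] by simp
qed (auto intro: step_comm step.tensor step.unit step.with1 step.with2 step.bang)

section \<open>Runs of silent steps\<close>

lemma tau_steps_refl [simp]: "tau_steps S S"
  by (simp add: tau_steps_def)

lemma tau_steps_trans [trans]: "tau_steps S T \<Longrightarrow> tau_steps T U \<Longrightarrow> tau_steps S U"
  unfolding tau_steps_def by (rule rtranclp_trans)

lemma step_imp_tau_steps: "step S Tau T \<Longrightarrow> tau_steps S T"
  unfolding tau_steps_def by (rule r_into_rtranclp)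

lemma step_tau_steps: "step S Tau T \<Longrightarrow> tau_steps T U \<Longrightarrow> tau_steps S U"
  using step_imp_tau_steps tau_steps_trans by blast

lemma tau_steps_frame:
  assumes "tau_steps (G, D) (G', D')"
  shows "tau_steps (G |\<union>| H, D + E) (G' |\<union>| H, D' + E)"
  using assms unfolding tau_steps_def
proof (induction "(G', D')" arbitrary: G' D' rule: rtranclp_induct)
  case (step T)
  obtain G1 D1 where T: "T = (G1, D1)" by fastforce
  show ?case
    using step(3)[OF T] step_Tau_frame[OF step(2)[unfolded T]]
    by (rule rtranclp.rtrancl_into_rtrancl)
qed simp

lemma tau_steps_compose_left: "tau_steps S S' \<Longrightarrow> tau_steps (compose S T) (compose S' T)"
  by (metis compose_def prod.collapse tau_steps_frame)

lemma compose_commute: "compose S T = compose T S"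
  by (simp add: compose_def funion_commute union_commute)

lemma tau_steps_compose:
  assumes "tau_steps S S'" "tau_steps T T'"
  shows "tau_steps (compose S T) (compose S' T')"
  by (metis assms compose_commute tau_steps_compose_left tau_steps_trans)

lemma tau_steps_union:
  assumes "tau_steps (G, D) (G1, D1)" "tau_steps (G, E) (G2, E2)"
  shows "tau_steps (G, D + E) (G1 |\<union>| G2, D1 + E2)"
  using tau_steps_compose[OF assms] by (simp add: compose_def)

text \<open>Each silent step is a left rule or \<open>clone\<close> read from conclusion to premise;
  communication is \<open>lolliL\<close> with \<open>init\<close> as its left premise.\<close>

lemma step_Tau_entails:
  assumes "step (G, D) Tau (G', D')" "entails G' D' C"
  shows "entails G D C"
  using assms(1)
proof (cases rule: step_Tau_cases)
  case (comm a B E)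
  then show ?thesis
    using entails.lolliL[OF entails.init, of G B E C a] assms(2) by (simp add: add_mset_commute)
next
  case (clone A)
  then show ?thesis using assms(2) entails.clone[of A] by auto
qed (use assms(2) in \<open>auto intro: entails_rules\<close>)

lemma tau_steps_entails:
  assumes "tau_steps (G, D) (G', D')" "entails G' D' C"
  shows "entails G D C"
  using assms unfolding tau_steps_def
proof (induction "(G, D)" arbitrary: G D rule: converse_rtranclp_induct)
  case (step T)
  obtain G1 D1 where T: "T = (G1, D1)" by fastforce
  show ?case
    using step_Tau_entails[OF step(1)[unfolded T] step(3)[OF T step(4)]] .
qed simp

text \<open>The condition under which the right rule for the succedent can finish the proof.
  \<open>With\<close>, \<open>Lolli\<close> and \<open>Top\<close> have invertible right rules and
  impose no condition; the first two are handled by the inversion lemmas instead.\<close>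

fun right_ready :: "'a form fset \<Rightarrow> 'a form multiset \<Rightarrow> 'a form \<Rightarrow> bool" where
  "right_ready G D (Atom a) \<longleftrightarrow> D = {#Atom a#}"
| "right_ready G D Unit \<longleftrightarrow> D = {#}"
| "right_ready G D (Tensor A B) \<longleftrightarrow> (\<exists>D1 D2. D = D1 + D2 \<and> entails G D1 A \<and> entails G D2 B)"
| "right_ready G D (Bang A) \<longleftrightarrow> D = {#} \<and> entails G {#} A"
| "right_ready G D _ \<longleftrightarrow> True"

lemma right_ready_union: "right_ready G D C \<Longrightarrow> right_ready (H |\<union>| G) D C"
  by (cases C) (auto intro: entails_union)

text \<open>Read from the conclusion upwards, left rules and \<open>clone\<close> are performed as
  silent steps until a right rule or \<open>init\<close> is met. \<open>lolliL\<close> first runs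
  its left premise to the bare atom, then communicates and follows its right premise.\<close>

lemma entails_focus:
  "entails G D C \<Longrightarrow> \<exists>G' D'. tau_steps (G, D) (G', D') \<and> right_ready G' D' C"
proof (induction rule: entails.induct)
  case (lolliL G D a B E C)
  then obtain G1 G2 E' where 1: "tau_steps (G, D) (G1, {#Atom a#})"
    and 2: "tau_steps (G, add_mset B E) (G2, E')" "right_ready G2 E' C"
    by auto
  \<comment> \<open>The implication waits while \<open>D\<close> is run to the atom. Framing with
    \<open>G\<close> keeps \<open>G\<close> inside the set reached, so that the second run can start
    there.\<close>
  have "tau_steps (G, D + add_mset (Lolli a B) E) (G1 |\<union>| G, {#Atom a#} + add_mset (Lolli a B) E)"
    using tau_steps_frame[OF 1, of G "add_mset (Lolli a B) E"] by (simp only: funion_absorb)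
  also have "tau_steps \<dots> (G1 |\<union>| G, add_mset B E)"
    using step_comm[of "G1 |\<union>| G"] by (auto simp: add_mset_commute intro: step_imp_tau_steps)
  also have "tau_steps \<dots> (G1 |\<union>| G2, E')"
    using tau_steps_frame[OF 2(1), of G1 "{#}"] by (simp add: funion_commute)
  finally show ?case
    using right_ready_union[OF 2(2)] by auto
next
  case (clone A G D C)
  then show ?case using step_tau_steps[OF step_clone] by blast
next
  case (tensorR G D A E B)
  then have "right_ready G (D + E) (Tensor A B)" by auto
  then show ?case using tau_steps_refl by blast
next
  case (tensorL G A B D C)
  then show ?case using step_tau_steps[OF step.tensor] by blast
next
  case (unitL G D C)
  then show ?case using step_tau_steps[OF step.unit] by blast
next
  case (withL1 G A D C B)
  then show ?case using step_tau_steps[OF step.with1] by blast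
next
  case (withL2 G B D C A)
  then show ?case using step_tau_steps[OF step.with2] by blast
next
  case (bangL A G D C)
  then show ?case using step_tau_steps[OF step.bang] by blast
next
  case (init G a)
  then have "right_ready G {#Atom a#} (Atom a)" by simp
  then show ?case using tau_steps_refl by blast
next
  case (unitR G)
  then have "right_ready G {#} Unit" by simp
  then show ?case using tau_steps_refl by blast
next
  case (withR G D A B)
  then have "right_ready G D (With A B)" by simp
  then show ?case using tau_steps_refl by blast
next
  case (topR G D)
  then have "right_ready G D Top" by simp
  then show ?case using tau_steps_refl by blast
next
  case (lolliR G a D B)
  then have "right_ready G D (Lolli a B)" by simp
  then show ?case using tau_steps_refl by blast
next
  case (bangR G A)
  then have "right_ready G {#} (Bang A)" by simp
  then show ?case using tau_steps_refl by blast
qed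

lemma entails_AtomD: "entails G D (Atom a) \<Longrightarrow> \<exists>G'. tau_steps (G, D) (G', {#Atom a#})"
  by (drule entails_focus) simp

lemma entails_UnitD: "entails G D Unit \<Longrightarrow> \<exists>G'. tau_steps (G, D) (G', {#})"
  by (drule entails_focus) simp

lemma entails_TensorD: "entails G D (Tensor A B) \<Longrightarrow>
    \<exists>G' D1 D2. tau_steps (G, D) (G', D1 + D2) \<and> entails G' D1 A \<and> entails G' D2 B"
  by (drule entails_focus) (simp, blast)

lemma entails_BangD: "entails G D (Bang A) \<Longrightarrow>
    \<exists>G'. tau_steps (G, D) (G', {#}) \<and> entails G' {#} A"
  by (drule entails_focus) simp

subsection \<open>Realisers and characteristic formulas\<close>

inductive entails_all :: "'a form fset \<Rightarrow> 'a form multiset \<Rightarrow> 'a form multiset \<Rightarrow> bool" for G where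
  empty: "entails_all G {#} {#}"
| add: "entails G D A \<Longrightarrow> entails_all G E F \<Longrightarrow> entails_all G (D + E) (add_mset A F)"

lemma entails_all_union:
  assumes "entails_all G D E"
  shows "entails_all (G |\<union>| H) D E" "entails_all (H |\<union>| G) D E"
  using assms by (induction; auto intro: entails_all.intros entails_union)+

lemma entails_all_emptyD: "entails_all G D {#} \<Longrightarrow> D = {#}"
  by (auto elim: entails_all.cases)

text \<open>The requested \<open>A\<close> need not be the formula added last; if it is not, it is
  found deeper and the summands are reordered.\<close>

lemma entails_all_addD:
  "entails_all G D (add_mset A F) \<Longrightarrow>
    \<exists>D1 D2. D = D1 + D2 \<and> entails G D1 A \<and> entails_all G D2 F"
proof (induction D "add_mset A F" arbitrary: F rule: entails_all.induct)
  case (add D B E F' F)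
  show ?case
  proof (cases "B = A")
    case True
    then show ?thesis using add by auto
  next
    case False
    then obtain K where K: "F' = add_mset A K" "F = add_mset B K"
      using add(4) by (auto simp: add_eq_conv_ex)
    then obtain D1 D2 where "E = D1 + D2" "entails G D1 A" "entails_all G D2 K"
      using add(3) by blast
    moreover have "entails_all G (D + D2) F"
      unfolding K by (intro entails_all.add add(1)) fact
    moreover have "D + (D1 + D2) = D1 + (D + D2)"
      by simp
    ultimately show ?thesis
      by blast
  qed
qed simp

text \<open>This is what makes realisers split along a composition.\<close>

lemma entails_all_unionD:
  "entails_all G D (F1 + F2) \<Longrightarrow>
    \<exists>D1 D2. D = D1 + D2 \<and> entails_all G D1 F1 \<and> entails_all G D2 F2"
proof (induction F1 arbitrary: D)
  case empty
  then have "D = {#} + D \<and> entails_all G {#} {#} \<and> entails_all G D F2"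
    by (simp add: entails_all.empty)
  then show ?case by blast
next
  case (add A F1)
  then obtain D1 D2 where "D = D1 + D2" "entails G D1 A" "entails_all G D2 (F1 + F2)"
    using entails_all_addD[of G D A "F1 + F2"] by auto
  moreover from this obtain E1 E2 where "D2 = E1 + E2" "entails_all G E1 F1" "entails_all G E2 F2"
    using add.IH by blast
  ultimately have "D = (D1 + E1) + E2" "entails_all G (D1 + E1) (add_mset A F1)" "entails_all G E2 F2"
    by (auto simp: union_assoc intro: entails_all.add)
  then show ?case by blast
qed

text \<open>Unrestricted formulas are proved from no linear resource, so that a realiser can copy
  them freely.\<close>

definition realises :: "'a state \<Rightarrow> 'a state \<Rightarrow> bool" where
  "realises T S \<longleftrightarrow>
    (\<forall>A. A |\<in>| fst S \<longrightarrow> entails (fst T) {#} A) \<and> entails_all (fst T) (snd T) (snd S)"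

text \<open>A preliminary run is allowed because a proof of a tensor, for instance, may have to
  unfold its context before that context splits.\<close>

definition reaches_realiser :: "'a state \<Rightarrow> 'a state \<Rightarrow> bool" where
  "reaches_realiser S T \<longleftrightarrow> (\<exists>U. tau_steps T U \<and> realises U S)"

lemma realises_imp_reaches: "realises T S \<Longrightarrow> reaches_realiser S T"
  unfolding reaches_realiser_def using tau_steps_refl by blast

lemma realises_add_mset:
  assumes "entails G D A" "realises (H, E) (\<Gamma>, \<Delta>)"
  shows "realises (G |\<union>| H, D + E) (\<Gamma>, add_mset A \<Delta>)"
  using assms
  by (auto simp: realises_def entails_union entails_all_union entails_all.add)

lemma realises_finsert:
  assumes "entails G {#} A" "realises (H, E) (\<Gamma>, \<Delta>)"
  shows "realises (G |\<union>| H, E) (finsert A \<Gamma>, \<Delta>)"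
  using assms by (auto simp: realises_def entails_union entails_all_union)

lemma realises_add_msetD:
  assumes "realises (G, D) (\<Gamma>, add_mset A \<Delta>)"
  obtains D1 D2 where "D = D1 + D2" "entails G D1 A" "realises (G, D2) (\<Gamma>, \<Delta>)"
proof -
  from assms have G: "\<forall>A. A |\<in>| \<Gamma> \<longrightarrow> entails G {#} A" and "entails_all G D (add_mset A \<Delta>)"
    by (auto simp: realises_def)
  then obtain D1 D2 where "D = D1 + D2" "entails G D1 A" "entails_all G D2 \<Delta>"
    using entails_all_addD by blast
  with G show ?thesis
    by (intro that[of D1 D2]) (auto simp: realises_def)
qed

text \<open>The step acts on the proofs of the formulas it consumes. Proofs of \<open>Atom\<close>,
  \<open>Tensor\<close>, \<open>Unit\<close> and \<open>Bang\<close> are run until the right rule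
  applies; proofs of \<open>With\<close> and \<open>Lolli\<close> are inverted.\<close>

lemma realises_step_Tau:
  assumes r: "realises (G, D) (\<Gamma>, \<Delta>)" and "step (\<Gamma>, \<Delta>) Tau S"
  shows "reaches_realiser S (G, D)"
  using assms(2)
proof (cases rule: step_Tau_cases)
  case (comm a B E)
  obtain D1 D' where D': "D = D1 + D'" "entails G D1 (Atom a)"
    "realises (G, D') (\<Gamma>, add_mset (Lolli a B) E)"
    using realises_add_msetD[OF r[unfolded comm(1)]] .
  obtain D2 D3 where "D' = D2 + D3" "entails G D2 (Lolli a B)" and r3: "realises (G, D3) (\<Gamma>, E)"
    using realises_add_msetD[OF D'(3)] .
  with D' have D: "D = D1 + (D2 + D3)" "entails G D1 (Atom a)" "entails G D2 (Lolli a B)"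
    by auto
  obtain H where "tau_steps (G, D1) (H, {#Atom a#})"
    using entails_AtomD[OF D(2)] by blast
  then have "tau_steps (G, D) (H |\<union>| G, add_mset (Atom a) D2 + D3)"
    using tau_steps_frame[of G D1 H "{#Atom a#}" G "D2 + D3"] D(1) by simp
  \<comment> \<open>The atom is not spent in a communication; it becomes the antecedent that the
    inverted proof of \<open>Lolli a B\<close> requires.\<close>
  moreover have "realises ((H |\<union>| G) |\<union>| G, add_mset (Atom a) D2 + D3) S"
    unfolding comm by (intro realises_add_mset[OF _ r3] entails_union(2) entails_lolli_inv D(3))
  then have "realises (H |\<union>| G, add_mset (Atom a) D2 + D3) S"
    by (simp add: funion_assoc)
  ultimately show ?thesis
    unfolding reaches_realiser_def by blast
next
  case (tensor A B E)
  obtain D1 D2 where D: "D = D1 + D2" "entails G D1 (Tensor A B)" "realises (G, D2) (\<Gamma>, E)"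
    using realises_add_msetD[OF r[unfolded tensor(1)]] .
  obtain H E1 E2 where H: "tau_steps (G, D1) (H, E1 + E2)" "entails H E1 A" "entails H E2 B"
    using entails_TensorD[OF D(2)] by blast
  \<comment> \<open>The repeated \<open>H\<close> matches the set produced by two uses of
    \<open>realises_add_mset\<close>.\<close>
  have "tau_steps (G, D) (H |\<union>| (H |\<union>| G), E1 + (E2 + D2))"
    using tau_steps_frame[OF H(1), of G D2] D(1) by (simp add: union_assoc)
  moreover have "realises (H |\<union>| (H |\<union>| G), E1 + (E2 + D2)) S"
    unfolding tensor by (intro realises_add_mset H D(3))
  ultimately show ?thesis
    unfolding reaches_realiser_def by blast
next
  case (unit E)
  obtain D1 D2 where D: "D = D1 + D2" "entails G D1 Unit" "realises (G, D2) (\<Gamma>, E)"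
    using realises_add_msetD[OF r[unfolded unit(1)]] .
  obtain H where H: "tau_steps (G, D1) (H, {#})"
    using entails_UnitD[OF D(2)] by blast
  have "tau_steps (G, D) (H |\<union>| G, D2)"
    using tau_steps_frame[OF H(1), of G D2] D(1) by simp
  moreover have "realises (H |\<union>| G, D2) S"
    using D(3) unit by (auto simp: realises_def entails_union entails_all_union)
  ultimately show ?thesis
    unfolding reaches_realiser_def by blast
next
  case (with1 A B E)
  obtain D1 D2 where D: "D = D1 + D2" "entails G D1 (With A B)" "realises (G, D2) (\<Gamma>, E)"
    using realises_add_msetD[OF r[unfolded with1(1)]] .
  have "realises (G |\<union>| G, D) S"
    unfolding with1 D(1) by (intro realises_add_mset entails_with_inv(1)[OF D(2)] D(3))
  then show ?thesis by (simp add: realises_imp_reaches)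
next
  case (with2 A B E)
  obtain D1 D2 where D: "D = D1 + D2" "entails G D1 (With A B)" "realises (G, D2) (\<Gamma>, E)"
    using realises_add_msetD[OF r[unfolded with2(1)]] .
  have "realises (G |\<union>| G, D) S"
    unfolding with2 D(1) by (intro realises_add_mset entails_with_inv(2)[OF D(2)] D(3))
  then show ?thesis by (simp add: realises_imp_reaches)
next
  case (bang A E)
  obtain D1 D2 where D: "D = D1 + D2" "entails G D1 (Bang A)" "realises (G, D2) (\<Gamma>, E)"
    using realises_add_msetD[OF r[unfolded bang(1)]] .
  obtain H where H: "tau_steps (G, D1) (H, {#})" "entails H {#} A"
    using entails_BangD[OF D(2)] by blast
  have "tau_steps (G, D) (H |\<union>| G, D2)"
    using tau_steps_frame[OF H(1), of G D2] D(1) by simp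
  moreover have "realises (H |\<union>| G, D2) S"
    unfolding bang by (intro realises_finsert H D(3))
  ultimately show ?thesis
    unfolding reaches_realiser_def by blast
next
  case (clone A)
  \<comment> \<open>A copy of an unrestricted formula costs nothing, so \<open>D\<close> already
    realises the enlarged multiset.\<close>
  then have "entails G {#} A" using r by (simp add: realises_def)
  from realises_add_mset[OF this r] show ?thesis
    using clone by (simp add: realises_imp_reaches)
qed

section \<open>Weak transitions and the simulation of realisers\<close>

lemma weak_step_Tau [simp]: "weak_step S Tau T \<longleftrightarrow> tau_steps S T"
  by (simp add: weak_step_def)

lemma weak_step_Out:
  "weak_step S (Out a) S' \<longleftrightarrow>
    (\<exists>G D. tau_steps S (G, add_mset (Atom a) D) \<and> tau_steps (G, D) S')"
  unfolding weak_step_def by (force simp: step_Out_iff)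

text \<open>For visible actions the consumed formula is exposed in the source state, so those
  clauses call for no analysis of \<open>step\<close>.\<close>

lemma simulationI:
  assumes "\<And>\<Gamma> T. R (\<Gamma>, {#}) T \<Longrightarrow> \<exists>G. tau_steps T (G, {#}) \<and> R (\<Gamma>, {#}) (G, {#})"
    and "\<And>S S' T. R (compose S S') T \<Longrightarrow>
      \<exists>U U'. tau_steps T (compose U U') \<and> R S U \<and> R S' U'"
    and "\<And>\<Gamma> \<Delta> S' T. R (\<Gamma>, \<Delta>) T \<Longrightarrow> step (\<Gamma>, \<Delta>) Tau S' \<Longrightarrow> \<exists>T'. tau_steps T T' \<and> R S' T'"
    and "\<And>\<Gamma> \<Delta> a T. R (\<Gamma>, add_mset (Atom a) \<Delta>) T \<Longrightarrow>
      \<exists>T'. weak_step T (Out a) T' \<and> R (\<Gamma>, \<Delta>) T'"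
    and "\<And>\<Gamma> \<Delta> a B G D. R (\<Gamma>, add_mset (Lolli a B) \<Delta>) (G, D) \<Longrightarrow>
      \<exists>T'. tau_steps (G, add_mset (Atom a) D) T' \<and> R (\<Gamma>, add_mset B \<Delta>) T'"
  shows "simulation R"
  unfolding simulation_def
proof (intro allI impI conjI)
  fix S T \<Gamma> assume "R S T" "S = (\<Gamma>, {#})"
  then show "\<exists>G. weak_step T Tau (G, {#}) \<and> R (\<Gamma>, {#}) (G, {#})"
    using assms(1) by simp
next
  fix S T S1 S2 assume "R S T" "S = compose S1 S2"
  then show "\<exists>U U'. weak_step T Tau (compose U U') \<and> R S1 U \<and> R S2 U'"
    using assms(2) by simp
next
  fix S T \<alpha> S' assume RST: "R S T" and step: "(\<alpha> = Tau \<or> (\<exists>a. \<alpha> = Out a)) \<and> step S \<alpha> S'"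
  obtain \<Gamma> \<Delta> where S: "S = (\<Gamma>, \<Delta>)" by fastforce
  from step consider "\<alpha> = Tau" "step S Tau S'" | a where "\<alpha> = Out a" "step S (Out a) S'"
    by blast
  then show "\<exists>T'. weak_step T \<alpha> T' \<and> R S' T'"
  proof cases
    case 1
    then show ?thesis using assms(3)[of \<Gamma> \<Delta> T S'] RST S by simp
  next
    case (2 a)
    then obtain E where "\<Delta> = add_mset (Atom a) E" "S' = (\<Gamma>, E)"
      using S by (auto simp: step_Out_iff)
    then show ?thesis using assms(4)[of \<Gamma> a E T] RST S 2 by simp
  qed
next
  fix S T a S' assume "R S T" "step S (In a) S'"
  moreover from this obtain \<Gamma> \<Delta> B where "S = (\<Gamma>, add_mset (Lolli a B) \<Delta>)" "S' = (\<Gamma>, add_mset B \<Delta>)"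
    by (cases S) (auto simp: step_In_iff)
  ultimately show "\<exists>T'. weak_step (fst T, add_mset (Atom a) (snd T)) Tau T' \<and> R S' T'"
    using assms(5)[of \<Gamma> a B \<Delta> "fst T" "snd T"] by simp
qed

text \<open>Emptiness and splitting are read off \<open>entails_all\<close>. An output runs the
  proof of the atom down to the atom, and an input inverts the proof of the implication.\<close>

lemma simulation_reaches_realiser: "simulation reaches_realiser"
proof (rule simulationI)
  fix \<Gamma> :: "'a form fset" and T
  assume "reaches_realiser (\<Gamma>, {#}) T"
  then obtain G D where "tau_steps T (G, D)" "realises (G, D) (\<Gamma>, {#})"
    unfolding reaches_realiser_def by fastforce
  moreover from this have "D = {#}"
    by (auto simp: realises_def dest: entails_all_emptyD)
  ultimately show "\<exists>G. tau_steps T (G, {#}) \<and> reaches_realiser (\<Gamma>, {#}) (G, {#})"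
    by (blast intro: realises_imp_reaches)
next
  fix S S' T :: "'a state"
  assume "reaches_realiser (compose S S') T"
  then obtain G D where T: "tau_steps T (G, D)" and r: "realises (G, D) (compose S S')"
    unfolding reaches_realiser_def by fastforce
  then obtain D1 D2 where D: "D = D1 + D2" "entails_all G D1 (snd S)" "entails_all G D2 (snd S')"
    by (auto simp: realises_def compose_def dest: entails_all_unionD)
  then have "realises (G, D1) S" "realises (G, D2) S'"
    using r by (auto simp: realises_def compose_def)
  moreover have "(G, D) = compose (G, D1) (G, D2)"
    using D by (simp add: compose_def)
  ultimately show "\<exists>U U'. tau_steps T (compose U U') \<and> reaches_realiser S U \<and> reaches_realiser S' U'"
    using T by (metis realises_imp_reaches)
next
  fix \<Gamma> \<Delta> and S' T :: "'a state"
  assume "reaches_realiser (\<Gamma>, \<Delta>) T" "step (\<Gamma>, \<Delta>) Tau S'"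
  then show "\<exists>T'. tau_steps T T' \<and> reaches_realiser S' T'"
    by (metis reaches_realiser_def realises_step_Tau surj_pair)
next
  fix \<Gamma> \<Delta> a and T :: "'a state"
  assume "reaches_realiser (\<Gamma>, add_mset (Atom a) \<Delta>) T"
  then obtain G D where T: "tau_steps T (G, D)" and r: "realises (G, D) (\<Gamma>, add_mset (Atom a) \<Delta>)"
    unfolding reaches_realiser_def by fastforce
  obtain D1 D2 where D: "D = D1 + D2" "entails G D1 (Atom a)" "realises (G, D2) (\<Gamma>, \<Delta>)"
    using realises_add_msetD[OF r] .
  obtain H where H: "tau_steps (G, D1) (H, {#Atom a#})"
    using entails_AtomD[OF D(2)] by blast
  have "tau_steps (G, D) (H |\<union>| G, add_mset (Atom a) D2)"
    using tau_steps_frame[OF H(1), of G D2] D(1) by simp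
  then have "weak_step T (Out a) (H |\<union>| G, D2)"
    using T tau_steps_trans tau_steps_refl unfolding weak_step_Out by blast
  moreover have "realises (H |\<union>| G, D2) (\<Gamma>, \<Delta>)"
    using D(3) by (auto simp: realises_def entails_union entails_all_union)
  ultimately show "\<exists>T'. weak_step T (Out a) T' \<and> reaches_realiser (\<Gamma>, \<Delta>) T'"
    by (blast intro: realises_imp_reaches)
next
  fix \<Gamma> \<Delta> a and B :: "'a form" and G D
  assume "reaches_realiser (\<Gamma>, add_mset (Lolli a B) \<Delta>) (G, D)"
  then obtain H E where T: "tau_steps (G, D) (H, E)"
    and r: "realises (H, E) (\<Gamma>, add_mset (Lolli a B) \<Delta>)"
    unfolding reaches_realiser_def by fastforce
  obtain D1 D2 where D: "E = D1 + D2" "entails H D1 (Lolli a B)" "realises (H, D2) (\<Gamma>, \<Delta>)"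
    using realises_add_msetD[OF r] .
  have "tau_steps (G, add_mset (Atom a) D) (H, add_mset (Atom a) E)"
    using tau_steps_frame[OF T, of "{||}" "{#Atom a#}"] by simp
  moreover have "realises (H, add_mset (Atom a) E) (\<Gamma>, add_mset B \<Delta>)"
    using realises_add_mset[OF entails_lolli_inv[OF D(2)] D(3)] D(1) by simp
  ultimately show "\<exists>T'. tau_steps (G, add_mset (Atom a) D) T' \<and>
      reaches_realiser (\<Gamma>, add_mset B \<Delta>) T'"
    by (blast intro: realises_imp_reaches)
qed

text \<open>The witness is the tensor of the formulas of \<Delta>, the banged formulas of \<Gamma>
  and a final \<open>Unit\<close>. The first clause ranges over all supersets \<open>G\<close> so
  that it survives inserting a further formula into \<Gamma>.\<close>

lemma characteristic_formula:
  "\<exists>F. (\<forall>G. \<Gamma> |\<subseteq>| G \<longrightarrow> entails G \<Delta> F) \<and>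
    (\<forall>G D. entails G D F \<longrightarrow> reaches_realiser (\<Gamma>, \<Delta>) (G, D))"
proof (induction \<Delta>)
  case empty
  show ?case
  proof (induction \<Gamma>)
    case empty
    have "reaches_realiser ({||}, {#}) (G, D)" if "entails G D Unit" for G D
      using entails_UnitD[OF that]
      by (auto simp: reaches_realiser_def realises_def intro: entails_all.empty)
    then show ?case by (intro exI[of _ Unit]) (auto intro: entails.unitR)
  next
    case (insert A \<Gamma>)
    then obtain F where F: "\<And>G. \<Gamma> |\<subseteq>| G \<Longrightarrow> entails G {#} F"
      "\<And>G D. entails G D F \<Longrightarrow> reaches_realiser (\<Gamma>, {#}) (G, D)"
      by blast
    have "entails G {#} (Tensor (Bang A) F)" if "finsert A \<Gamma> |\<subseteq>| G" for G
    proof -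
      have "entails G {#} A"
        using that by (auto intro: entails.clone[OF _ entails_identity])
      then have "entails G ({#} + {#}) (Tensor (Bang A) F)"
        using that by (intro entails.tensorR entails.bangR F) auto
      then show ?thesis by simp
    qed
    moreover have "reaches_realiser (finsert A \<Gamma>, {#}) (G, D)"
      if D: "entails G D (Tensor (Bang A) F)" for G D
    proof -
      obtain G' D1 D2 where D: "tau_steps (G, D) (G', D1 + D2)" "entails G' D1 (Bang A)" "entails G' D2 F"
        using entails_TensorD[OF D] by blast
      obtain H1 where H1: "tau_steps (G', D1) (H1, {#})" "entails H1 {#} A"
        using entails_BangD[OF D(2)] by blast
      obtain H2 E where H2: "tau_steps (G', D2) (H2, E)" "realises (H2, E) (\<Gamma>, {#})"
        using F(2)[OF D(3)] unfolding reaches_realiser_def by fastforce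
      \<comment> \<open>The two parts of the split are run independently and the sets they reach are
        united.\<close>
      have "tau_steps (G, D) (H1 |\<union>| H2, E)"
        using tau_steps_trans[OF D(1) tau_steps_union[OF H1(1) H2(1)]] by simp
      then show ?thesis
        using realises_finsert[OF H1(2) H2(2)] unfolding reaches_realiser_def by blast
    qed
    ultimately show ?case by blast
  qed
next
  case (add A \<Delta>)
  then obtain F where F: "\<And>G. \<Gamma> |\<subseteq>| G \<Longrightarrow> entails G \<Delta> F"
    "\<And>G D. entails G D F \<Longrightarrow> reaches_realiser (\<Gamma>, \<Delta>) (G, D)"
    by blast
  have "entails G (add_mset A \<Delta>) (Tensor A F)" if "\<Gamma> |\<subseteq>| G" for G
    using entails.tensorR[OF entails_identity F(1)[OF that], of A] by simp
  moreover have "reaches_realiser (\<Gamma>, add_mset A \<Delta>) (G, D)"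
    if D: "entails G D (Tensor A F)" for G D
  proof -
    obtain G' D1 D2 where D: "tau_steps (G, D) (G', D1 + D2)" "entails G' D1 A" "entails G' D2 F"
      using entails_TensorD[OF D] by blast
    obtain H E where H: "tau_steps (G', D2) (H, E)" "realises (H, E) (\<Gamma>, \<Delta>)"
      using F(2)[OF D(3)] unfolding reaches_realiser_def by fastforce
    have "tau_steps (G, D) (G' |\<union>| H, D1 + E)"
      using tau_steps_trans[OF D(1) tau_steps_union[OF tau_steps_refl H(1)]] by simp
    then show ?thesis
      using realises_add_mset[OF D(2) H(2)] unfolding reaches_realiser_def by blast
  qed
  ultimately show ?case by blast
qed

subsection \<open>Similarity is a precongruence preserving derivability\<close>

text \<open>Similarity inherits every simulation clause, since the simulation witnessing a pair also
  contains its residuals; this and the next four lemmas record the clauses.\<close>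

lemma sim_preorder_empty:
  assumes "(\<Gamma>, {#}) \<preceq>\<^sub>s T"
  shows "\<exists>G. tau_steps T (G, {#}) \<and> (\<Gamma>, {#}) \<preceq>\<^sub>s (G, {#})"
proof -
  obtain R where R: "simulation R" "R (\<Gamma>, {#}) T"
    using assms by (auto simp: sim_preorder_def)
  then have "\<exists>G. weak_step T Tau (G, {#}) \<and> R (\<Gamma>, {#}) (G, {#})"
    unfolding simulation_def by blast
  then show ?thesis
    using R(1) unfolding sim_preorder_def weak_step_Tau by blast
qed

lemma sim_preorder_compose:
  assumes "compose S S' \<preceq>\<^sub>s T"
  shows "\<exists>U U'. tau_steps T (compose U U') \<and> S \<preceq>\<^sub>s U \<and> S' \<preceq>\<^sub>s U'"
proof -
  obtain R where R: "simulation R" "R (compose S S') T"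
    using assms by (auto simp: sim_preorder_def)
  then have "\<exists>U U'. weak_step T Tau (compose U U') \<and> R S U \<and> R S' U'"
    unfolding simulation_def by blast
  then show ?thesis
    using R(1) unfolding sim_preorder_def weak_step_Tau by blast
qed

lemma sim_preorder_Tau:
  assumes "S \<preceq>\<^sub>s T" "step S Tau S'"
  shows "\<exists>T'. tau_steps T T' \<and> S' \<preceq>\<^sub>s T'"
proof -
  obtain R where R: "simulation R" "R S T"
    using assms by (auto simp: sim_preorder_def)
  then have "\<exists>T'. weak_step T Tau T' \<and> R S' T'"
    using assms(2) unfolding simulation_def by blast
  then show ?thesis
    using R(1) unfolding sim_preorder_def weak_step_Tau by blast
qed

lemma sim_preorder_Out:
  assumes "(\<Gamma>, add_mset (Atom a) \<Delta>) \<preceq>\<^sub>s T"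
  shows "\<exists>T'. weak_step T (Out a) T' \<and> (\<Gamma>, \<Delta>) \<preceq>\<^sub>s T'"
proof -
  obtain R where R: "simulation R" "R (\<Gamma>, add_mset (Atom a) \<Delta>) T"
    using assms by (auto simp: sim_preorder_def)
  then have "\<exists>T'. weak_step T (Out a) T' \<and> R (\<Gamma>, \<Delta>) T'"
    using step.out[of \<Gamma> a \<Delta>] unfolding simulation_def by blast
  then show ?thesis
    using R(1) unfolding sim_preorder_def by blast
qed

lemma sim_preorder_In:
  assumes "(\<Gamma>, add_mset (Lolli a B) \<Delta>) \<preceq>\<^sub>s (G, D)"
  shows "\<exists>T'. tau_steps (G, add_mset (Atom a) D) T' \<and> (\<Gamma>, add_mset B \<Delta>) \<preceq>\<^sub>s T'"
proof -
  obtain R where R: "simulation R" "R (\<Gamma>, add_mset (Lolli a B) \<Delta>) (G, D)"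
    using assms by (auto simp: sim_preorder_def)
  then have "\<exists>T'. weak_step (fst (G, D), add_mset (Atom a) (snd (G, D))) Tau T' \<and>
      R (\<Gamma>, add_mset B \<Delta>) T'"
    using step.inp[of \<Gamma> a B \<Delta>] unfolding simulation_def by blast
  then show ?thesis
    using R(1) unfolding sim_preorder_def weak_step_Tau fst_conv snd_conv by blast
qed

text \<open>Only a communication can involve both components, in either direction; every other
  silent step stays inside one of them.\<close>

lemma step_Tau_compose_cases [consumes 1, case_names left right out_in in_out]:
  assumes "step (compose S T) Tau U"
  obtains S' where "step S Tau S'" "U = compose S' T"
  | T' where "step T Tau T'" "U = compose S T'"
  | a S' T' where "step S (Out a) S'" "step T (In a) T'" "U = compose S' T'"
  | a S' T' where "step S (In a) S'" "step T (Out a) T'" "U = compose S' T'"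
proof -
  obtain G D H E where ST: "S = (G, D)" "T = (H, E)" by fastforce
  have split: "(\<exists>D'. D = add_mset A D' \<and> F = D' + E) \<or> (\<exists>E'. E = add_mset A E' \<and> F = D + E')"
    if "D + E = add_mset A F" for A F
  proof -
    have "A \<in># D + E" using that by simp
    then consider D' where "D = add_mset A D'" | E' where "E = add_mset A E'"
      by (metis mset_add union_iff)
    then show ?thesis using that by cases auto
  qed
  have "step (G |\<union>| H, D + E) Tau U"
    using assms by (simp add: ST compose_def)
  then show ?thesis
  proof (cases rule: step_Tau_cases)
    case (comm a B F)
    from split[OF comm(1)] show ?thesis
    proof (elim disjE exE conjE)
      fix D' assume D': "D = add_mset (Atom a) D'" "add_mset (Lolli a B) F = D' + E"
      from split[of "Lolli a B" "add_mset (Atom a) F"] comm(1)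
      consider D'' where "D = add_mset (Lolli a B) D''" "add_mset (Atom a) F = D'' + E"
        | E' where "E = add_mset (Lolli a B) E'" "add_mset (Atom a) F = D + E'"
        by (auto simp: add_mset_commute)
      then show ?thesis
      proof cases
        case 1
        \<comment> \<open>Both partners lie in \<open>D\<close> and are distinct formulas, so they
          can be removed together and the communication is internal to \<open>S\<close>.\<close>
        then obtain K where K: "D = add_mset (Atom a) (add_mset (Lolli a B) K)"
          using D'(1) by (auto simp: add_eq_conv_ex)
        then have "F = K + E" using comm(1) by simp
        then show ?thesis
          using K comm(2) by (intro that(1)[of "(G, add_mset B K)"])
            (auto simp: ST compose_def intro: step_comm)
      next
        case 2
        then have "F = D' + E'" using D' by simp
        then show ?thesis
          using 2 D' comm(2) by (intro that(3)[of a "(G, D')" "(H, add_mset B E')"])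
            (auto simp: ST compose_def step_Out_iff step_In_iff)
      qed
    next
      fix E' assume E': "E = add_mset (Atom a) E'" "add_mset (Lolli a B) F = D + E'"
      from split[of "Lolli a B" "add_mset (Atom a) F"] comm(1)
      consider E'' where "E = add_mset (Lolli a B) E''" "add_mset (Atom a) F = D + E''"
        | D' where "D = add_mset (Lolli a B) D'" "add_mset (Atom a) F = D' + E"
        by (auto simp: add_mset_commute)
      then show ?thesis
      proof cases
        case 1
        then obtain K where K: "E = add_mset (Atom a) (add_mset (Lolli a B) K)"
          using E'(1) by (auto simp: add_eq_conv_ex)
        then have "F = D + K" using comm(1) by simp
        then show ?thesis
          using K comm(2) by (intro that(2)[of "(H, add_mset B K)"])
            (auto simp: ST compose_def intro: step_comm)
      next
        case 2
        then have "F = D' + E'" using E' by simp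
        then show ?thesis
          using 2 E' comm(2) by (intro that(4)[of a "(G, add_mset B D')" "(H, E')"])
            (auto simp: ST compose_def step_Out_iff step_In_iff)
      qed
    qed
  next
    case (tensor A B F)
    from split[OF tensor(1)] tensor(2) that(1,2) show ?thesis
      by (fastforce simp: ST compose_def intro: step.tensor)
  next
    case (unit F)
    from split[OF unit(1)] unit(2) that(1,2) show ?thesis
      by (fastforce simp: ST compose_def intro: step.unit)
  next
    case (with1 A B F)
    from split[OF with1(1)] with1(2) that(1,2) show ?thesis
      by (fastforce simp: ST compose_def intro: step.with1)
  next
    case (with2 A B F)
    from split[OF with2(1)] with2(2) that(1,2) show ?thesis
      by (fastforce simp: ST compose_def intro: step.with2)
  next
    case (bang A F)
    from split[OF bang(1)] bang(2) that(1,2) show ?thesis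
      by (fastforce simp: ST compose_def intro: step.bang)
  next
    case (clone A)
    then show ?thesis
      using that(1)[of "(G, add_mset A D)"] that(2)[of "(H, add_mset A E)"] step_clone
      by (auto simp: ST compose_def)
  qed
qed

text \<open>Riesz refinement for multisets, used to cut one decomposition of a state along
  another.\<close>

lemma multiset_refinement:
  fixes X Y A B :: "'b multiset"
  assumes "X + Y = A + B"
  obtains P Q R T where "X = P + Q" "Y = R + T" "A = P + R" "B = Q + T"
proof
  have count: "count X z + count Y z = count A z + count B z" for z
    using assms by (metis count_union)
  \<comment> \<open>The witnesses are \<open>P = X \<inter># A\<close>, \<open>Q = X - A\<close>,
    \<open>R = A - X\<close> and \<open>T = B - (X - A)\<close>.\<close>
  show "X = X \<inter># A + (X - A)" "A = X \<inter># A + (A - X)"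
    by (auto intro!: multiset_eqI)
  show "Y = (A - X) + (B - (X - A))"
  proof (rule multiset_eqI)
    show "count Y z = count ((A - X) + (B - (X - A))) z" for z
      using count[of z] by simp
  qed
  show "B = (X - A) + (B - (X - A))"
  proof (rule multiset_eqI)
    show "count B z = count ((X - A) + (B - (X - A))) z" for z
      using count[of z] by simp
  qed
qed

lemma compose_refinement:
  assumes "compose U V = compose S T"
  obtains S1 S2 T1 T2 where
    "U = compose S1 T1" "V = compose S2 T2" "S = compose S1 S2" "T = compose T1 T2"
proof -
  have G: "fst U |\<union>| fst V = fst S |\<union>| fst T" and D: "snd U + snd V = snd S + snd T"
    using assms by (simp_all add: compose_def)
  obtain P Q R K where "snd U = P + Q" "snd V = R + K" "snd S = P + R" "snd T = Q + K"
    using multiset_refinement[OF D] .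
  \<comment> \<open>Set parts may overlap, so pairwise intersections serve as their
    refinement.\<close>
  with G show ?thesis
    by (intro that[of "(fst U |\<inter>| fst S, P)" "(fst U |\<inter>| fst T, Q)"
          "(fst V |\<inter>| fst S, R)" "(fst V |\<inter>| fst T, K)"])
      (auto simp: compose_def prod_eq_iff)
qed

lemma compose_assoc: "compose (compose S T) U = compose S (compose T U)"
  by (simp add: compose_def funion_assoc union_assoc)

text \<open>The closure of similarity under a shared bystander is itself a simulation. When the
  bystander emits an atom to \<open>S\<close>, the input clause adds exactly that atom to the
  target.\<close>

lemma sim_preorder_frame:
  assumes "S \<preceq>\<^sub>s S'"
  shows "compose S T \<preceq>\<^sub>s compose S' T"
proof -
  define R where "R U V \<longleftrightarrow> (\<exists>S S' T. U = compose S T \<and> V = compose S' T \<and> S \<preceq>\<^sub>s S')"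
    for U V :: "'a state"
  have R_I: "R (compose S T) (compose S' T)" if "S \<preceq>\<^sub>s S'" for S S' T
    unfolding R_def using that by blast
  have "simulation R"
  proof (rule simulationI)
    fix \<Gamma> V assume "R (\<Gamma>, {#}) V"
    then obtain G H S' where "(\<Gamma>, {#}) = compose (G, {#}) (H, {#})"
      "V = compose S' (H, {#})" "(G, {#}) \<preceq>\<^sub>s S'"
      by (auto simp: R_def compose_def)
    moreover from this obtain G' where "tau_steps S' (G', {#})" "(G, {#}) \<preceq>\<^sub>s (G', {#})"
      using sim_preorder_empty by blast
    ultimately have "tau_steps V (compose (G', {#}) (H, {#}))"
      "R (\<Gamma>, {#}) (compose (G', {#}) (H, {#}))"
      by (auto intro: tau_steps_compose_left R_I)
    then show "\<exists>G. tau_steps V (G, {#}) \<and> R (\<Gamma>, {#}) (G, {#})"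
      by (auto simp: compose_def)
  next
    fix U1 U2 V assume "R (compose U1 U2) V"
    then obtain S S' T where U: "compose U1 U2 = compose S T" and V: "V = compose S' T" and S: "S \<preceq>\<^sub>s S'"
      by (auto simp: R_def)
    \<comment> \<open>The bystander is cut along with \<open>S\<close>, so each half again has the
      form that \<open>R\<close> asks for.\<close>
    obtain S1 S2 T1 T2 where eqs: "U1 = compose S1 T1" "U2 = compose S2 T2"
      "S = compose S1 S2" "T = compose T1 T2"
      using compose_refinement[OF U] .
    obtain S1' S2' where S': "tau_steps S' (compose S1' S2')" "S1 \<preceq>\<^sub>s S1'" "S2 \<preceq>\<^sub>s S2'"
      using S sim_preorder_compose unfolding eqs by blast
    have "compose (compose S1' S2') T = compose (compose S1' T1) (compose S2' T2)"
      unfolding eqs by (metis compose_assoc compose_commute)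
    then have "tau_steps V (compose (compose S1' T1) (compose S2' T2))"
      using tau_steps_compose_left[OF S'(1), of T] V by simp
    then show "\<exists>V1 V2. tau_steps V (compose V1 V2) \<and> R U1 V1 \<and> R U2 V2"
      using R_I S' eqs by blast
  next
    fix \<Gamma> \<Delta> U' V assume "R (\<Gamma>, \<Delta>) V" and step: "step (\<Gamma>, \<Delta>) Tau U'"
    then obtain S S' T where U: "(\<Gamma>, \<Delta>) = compose S T" and V: "V = compose S' T" and S: "S \<preceq>\<^sub>s S'"
      by (auto simp: R_def)
    from step show "\<exists>V'. tau_steps V V' \<and> R U' V'"
      unfolding U
    proof (cases rule: step_Tau_compose_cases)
      case (left S1)
      then show ?thesis
        using sim_preorder_Tau[OF S] V tau_steps_compose_left R_I by blast
    next
      case (right T')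
      then have "tau_steps V (compose S' T')"
        using V by (metis compose_commute step_imp_tau_steps tau_steps_compose_left)
      then show ?thesis
        using right R_I[OF S] by blast
    next
      case (out_in a S1 T')
      then obtain G D where S1: "S = (G, add_mset (Atom a) D)" "S1 = (G, D)"
        by (cases S) (auto simp: step_Out_iff)
      obtain S'' where "weak_step S' (Out a) S''" "S1 \<preceq>\<^sub>s S''"
        using sim_preorder_Out[OF S[unfolded S1(1)]] S1(2) by blast
      then obtain K K' where K: "tau_steps S' K" "step K (Out a) K'" "tau_steps K' S''"
        by (auto simp: weak_step_def)
      \<comment> \<open>The silent steps of \<open>S'\<close> before and after its output are framed
        by \<open>T\<close> and \<open>T'\<close>, with one communication between them.\<close>
      have "tau_steps V (compose K T)"
        using K V by (simp add: tau_steps_compose_left)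
      also have "tau_steps \<dots> (compose K' T')"
        by (intro step_imp_tau_steps step.comm[OF K(2) out_in(2)])
      also have "tau_steps \<dots> (compose S'' T')"
        using K by (simp add: tau_steps_compose_left)
      finally show ?thesis
        using out_in R_I \<open>S1 \<preceq>\<^sub>s S''\<close> by blast
    next
      case (in_out a S1 T')
      then obtain G B D where S1: "S = (G, add_mset (Lolli a B) D)" "S1 = (G, add_mset B D)"
        by (cases S) (auto simp: step_In_iff)
      obtain G' D' where S': "S' = (G', D')" by fastforce
      from in_out obtain H E where T: "T = (H, add_mset (Atom a) E)" "T' = (H, E)"
        by (cases T) (auto simp: step_Out_iff)
      obtain S'' where S'': "tau_steps (G', add_mset (Atom a) D') S''" "S1 \<preceq>\<^sub>s S''"
        using sim_preorder_In[OF S[unfolded S1(1) S']] S1(2) by blast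
      \<comment> \<open>Reassigning the atom from the bystander to \<open>S'\<close> leaves the
        composition unchanged, so the target makes no move here.\<close>
      have "V = compose (G', add_mset (Atom a) D') T'"
        by (simp add: V S' T compose_def)
      then have "tau_steps V (compose S'' T')"
        using S'' by (simp add: tau_steps_compose_left)
      then show ?thesis
        using in_out R_I S'' by blast
    qed
  next
    fix \<Gamma> \<Delta> a V assume "R (\<Gamma>, add_mset (Atom a) \<Delta>) V"
    then obtain G D H E S' where
      eq: "\<Gamma> = G |\<union>| H" "add_mset (Atom a) \<Delta> = D + E" "V = compose S' (H, E)" and S: "(G, D) \<preceq>\<^sub>s S'"
      by (auto simp: R_def compose_def)
    have "Atom a \<in># D + E" using eq(2) by (metis union_single_eq_member)
    then consider D' where "D = add_mset (Atom a) D'" | E' where "E = add_mset (Atom a) E'"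
      by (metis mset_add union_iff)
    then show "\<exists>V'. weak_step V (Out a) V' \<and> R (\<Gamma>, \<Delta>) V'"
    proof cases
      case 1
      then have U': "(\<Gamma>, \<Delta>) = compose (G, D') (H, E)" using eq by (simp add: compose_def)
      obtain S'' where S'': "weak_step S' (Out a) S''" "(G, D') \<preceq>\<^sub>s S''"
        using sim_preorder_Out[OF S[unfolded 1]] by blast
      then obtain K L where K: "tau_steps S' (K, add_mset (Atom a) L)" "tau_steps (K, L) S''"
        by (auto simp: weak_step_Out)
      have "tau_steps V (K |\<union>| H, add_mset (Atom a) (L + E))"
        using tau_steps_compose_left[OF K(1), of "(H, E)"] eq(3) by (simp add: compose_def)
      moreover have "tau_steps (K |\<union>| H, L + E) (compose S'' (H, E))"
        using tau_steps_compose_left[OF K(2), of "(H, E)"] by (simp add: compose_def)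
      ultimately have "weak_step V (Out a) (compose S'' (H, E))"
        unfolding weak_step_Out by blast
      then show ?thesis
        using R_I[OF S''(2)] U' by metis
    next
      case 2
      then have U': "(\<Gamma>, \<Delta>) = compose (G, D) (H, E')" using eq by (simp add: compose_def)
      \<comment> \<open>The bystander owns the atom, so \<open>S'\<close> stays as it is.\<close>
      have "weak_step V (Out a) (compose S' (H, E'))"
        unfolding weak_step_Out eq(3) 2
        by (intro exI[of _ "fst S' |\<union>| H"] exI[of _ "snd S' + E'"]) (simp add: compose_def)
      then show ?thesis
        using R_I[OF S] U' by metis
    qed
  next
    fix \<Gamma> \<Delta> a B K L assume "R (\<Gamma>, add_mset (Lolli a B) \<Delta>) (K, L)"
    then obtain G D H E G' D' where eq: "\<Gamma> = G |\<union>| H" "add_mset (Lolli a B) \<Delta> = D + E"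
      "K = G' |\<union>| H" "L = D' + E" and S: "(G, D) \<preceq>\<^sub>s (G', D')"
      by (auto simp: R_def compose_def)
    have "Lolli a B \<in># D + E" using eq(2) by (metis union_single_eq_member)
    then consider D1 where "D = add_mset (Lolli a B) D1" | E1 where "E = add_mset (Lolli a B) E1"
      by (metis mset_add union_iff)
    then show "\<exists>V'. tau_steps (K, add_mset (Atom a) L) V' \<and> R (\<Gamma>, add_mset B \<Delta>) V'"
    proof cases
      case 1
      then have U': "(\<Gamma>, add_mset B \<Delta>) = compose (G, add_mset B D1) (H, E)"
        using eq by (simp add: compose_def)
      obtain S'' where S'': "tau_steps (G', add_mset (Atom a) D') S''" "(G, add_mset B D1) \<preceq>\<^sub>s S''"
        using sim_preorder_In[OF S[unfolded 1]] by blast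
      have "tau_steps (K, add_mset (Atom a) L) (compose S'' (H, E))"
        using tau_steps_compose_left[OF S''(1), of "(H, E)"] eq by (simp add: compose_def)
      then show ?thesis
        using R_I[OF S''(2)] U' by metis
    next
      case 2
      then have U': "(\<Gamma>, add_mset B \<Delta>) = compose (G, D) (H, add_mset B E1)"
        using eq by (simp add: compose_def)
      \<comment> \<open>The implication lies in the shared bystander, where it consumes the atom
        added to the target.\<close>
      have "tau_steps (K, add_mset (Atom a) L) (compose (G', D') (H, add_mset B E1))"
        using step_comm[of K a B "D' + E1"] eq 2
        by (intro step_imp_tau_steps) (simp add: compose_def)
      then show ?thesis
        using R_I[OF S] U' by metis
    qed
  qed
  then show ?thesis
    using R_I[OF assms] unfolding sim_preorder_def by blast
qed

section \<open>Similarity preserves derivability\<close>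

lemma sim_preorder_step_entails:
  assumes "step S Tau S'" "S \<preceq>\<^sub>s (G, D)" "\<And>G D. S' \<preceq>\<^sub>s (G, D) \<Longrightarrow> entails G D C"
  shows "entails G D C"
proof -
  obtain G' D' where "tau_steps (G, D) (G', D')" "S' \<preceq>\<^sub>s (G', D')"
    using sim_preorder_Tau[OF assms(2,1)] by fastforce
  then show ?thesis
    using assms(3) tau_steps_entails by blast
qed

text \<open>A proof of an atom runs to the atom alone, and this run can be prefixed to the other
  proof; hence cut on atoms is immediate.\<close>

lemma entails_cut_atom:
  assumes "entails G D (Atom a)" "entails H (add_mset (Atom a) E) C"
  shows "entails (G |\<union>| H) (D + E) C"
proof -
  obtain G' where "tau_steps (G, D) (G', {#Atom a#})"
    using entails_AtomD[OF assms(1)] by blast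
  then have "tau_steps (G |\<union>| H, D + E) (G' |\<union>| H, add_mset (Atom a) E)"
    using tau_steps_frame[of G D G' "{#Atom a#}" H E] by simp
  then show ?thesis
    using tau_steps_entails entails_union(2)[OF assms(2)] by blast
qed

text \<open>\<open>clone\<close> and the left rules other than \<open>lolliL\<close> are matched as
  silent steps and pulled back along the matching run. \<open>tensorR\<close> uses the splitting
  clause, \<open>unitR\<close> and \<open>bangR\<close> the emptiness clause, \<open>lolliR\<close>
  the precongruence property.\<close>

lemma sim_preorder_entails:
  "entails \<Gamma> \<Delta> C \<Longrightarrow> (\<Gamma>, \<Delta>) \<preceq>\<^sub>s (G, D) \<Longrightarrow> entails G D C"
proof (induction arbitrary: G D rule: entails.induct)
  case (init \<Gamma> a)
  obtain T' where T': "weak_step (G, D) (Out a) T'" "(\<Gamma>, {#}) \<preceq>\<^sub>s T'"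
    using sim_preorder_Out[OF init] by blast
  \<comment> \<open>After the output the target simulates an empty multiset, so its leftover
    resources can be discharged silently.\<close>
  then obtain H E K where H: "tau_steps (G, D) (H, add_mset (Atom a) E)" "tau_steps (H, E) (K, {#})"
    unfolding weak_step_Out using sim_preorder_empty tau_steps_trans by blast
  \<comment> \<open>The discharge is replayed with the atom still in place, which ends in an
    instance of \<open>init\<close>.\<close>
  have "tau_steps (H, add_mset (Atom a) E) (K, {#Atom a#})"
    using tau_steps_frame[OF H(2), of "{||}" "{#Atom a#}"] by simp
  then have "tau_steps (G, D) (K, {#Atom a#})"
    by (rule tau_steps_trans[OF H(1)])
  then show ?case
    by (rule tau_steps_entails[OF _ entails.init])
next
  case (clone A \<Gamma> \<Delta> C)
  show ?case by (rule sim_preorder_step_entails[OF step_clone[OF clone.hyps(1)] clone.prems clone.IH])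
next
  case (tensorR \<Gamma> \<Delta>1 A \<Delta>2 B)
  have "(\<Gamma>, \<Delta>1 + \<Delta>2) = compose (\<Gamma>, \<Delta>1) (\<Gamma>, \<Delta>2)"
    by (simp add: compose_def)
  then obtain G1 D1 G2 D2 where T: "tau_steps (G, D) (compose (G1, D1) (G2, D2))"
    "(\<Gamma>, \<Delta>1) \<preceq>\<^sub>s (G1, D1)" "(\<Gamma>, \<Delta>2) \<preceq>\<^sub>s (G2, D2)"
    using sim_preorder_compose tensorR.prems by (metis surj_pair)
  have "entails (G1 |\<union>| G2) (D1 + D2) (Tensor A B)"
    by (rule entails.tensorR[OF entails_union(1)[OF tensorR.IH(1)[OF T(2)]]
          entails_union(2)[OF tensorR.IH(2)[OF T(3)]]])
  then show ?case
    using T(1) by (simp add: compose_def tau_steps_entails)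
next
  case (tensorL \<Gamma> A B \<Delta> C)
  show ?case by (rule sim_preorder_step_entails[OF step.tensor tensorL.prems tensorL.IH])
next
  case (unitR \<Gamma>)
  obtain G' where "tau_steps (G, D) (G', {#})"
    using sim_preorder_empty[OF unitR] by blast
  then show ?case
    by (rule tau_steps_entails[OF _ entails.unitR])
next
  case (unitL \<Gamma> \<Delta> C)
  show ?case by (rule sim_preorder_step_entails[OF step.unit unitL.prems unitL.IH])
next
  case (withL1 \<Gamma> A \<Delta> C B)
  show ?case by (rule sim_preorder_step_entails[OF step.with1 withL1.prems withL1.IH])
next
  case (withL2 \<Gamma> B \<Delta> C A)
  show ?case by (rule sim_preorder_step_entails[OF step.with2 withL2.prems withL2.IH])
next
  case (lolliR \<Gamma> a \<Delta> B)
  have "(\<Gamma>, add_mset (Atom a) \<Delta>) \<preceq>\<^sub>s (G, add_mset (Atom a) D)"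
    using sim_preorder_frame[OF lolliR.prems, of "({||}, {#Atom a#})"] by (simp add: compose_def)
  then show ?case
    by (intro entails.lolliR lolliR.IH)
next
  case (lolliL \<Gamma> \<Delta>1 a B \<Delta>2 C)
  have "(\<Gamma>, add_mset (Lolli a B) (\<Delta>1 + \<Delta>2)) = compose (\<Gamma>, \<Delta>1) (\<Gamma>, add_mset (Lolli a B) \<Delta>2)"
    by (simp add: compose_def)
  then obtain G1 D1 G2 D2 where T: "tau_steps (G, D) (compose (G1, D1) (G2, D2))"
    "(\<Gamma>, \<Delta>1) \<preceq>\<^sub>s (G1, D1)" "(\<Gamma>, add_mset (Lolli a B) \<Delta>2) \<preceq>\<^sub>s (G2, D2)"
    using sim_preorder_compose lolliL.prems by (metis surj_pair)
  obtain H E where H: "tau_steps (G2, add_mset (Atom a) D2) (H, E)" "(\<Gamma>, add_mset B \<Delta>2) \<preceq>\<^sub>s (H, E)"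
    using sim_preorder_In[OF T(3)] by fastforce
  \<comment> \<open>The atom supplied by the input clause is cut against the part simulating the
    left premise.\<close>
  have "entails (G1 |\<union>| G2) (D1 + D2) C"
    using entails_cut_atom[OF lolliL.IH(1)[OF T(2)] tau_steps_entails[OF H(1) lolliL.IH(2)[OF H(2)]]] .
  then show ?case
    using T(1) by (simp add: compose_def tau_steps_entails)
next
  case (bangR \<Gamma> A)
  obtain G' where "tau_steps (G, D) (G', {#})" and G': "(\<Gamma>, {#}) \<preceq>\<^sub>s (G', {#})"
    using sim_preorder_empty[OF bangR.prems] by blast
  then show ?case
    by (intro tau_steps_entails[OF _ entails.bangR[OF bangR.IH[OF G']]])
next
  case (bangL A \<Gamma> \<Delta> C)
  show ?case by (rule sim_preorder_step_entails[OF step.bang bangL.prems bangL.IH])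
qed (auto intro: entails.withR entails.topR)

section \<open>Agreement of the two preorders over a common unrestricted part\<close>

theorem theorem4:
  fixes \<Gamma> :: "'a form fset" and \<Delta>\<^sub>1 \<Delta>\<^sub>2 :: "'a form multiset"
  shows "(mset_set (fset \<Gamma>), \<Delta>\<^sub>1) \<preceq>\<^sub>l (mset_set (fset \<Gamma>), \<Delta>\<^sub>2) \<longleftrightarrow> (\<Gamma>, \<Delta>\<^sub>1) \<preceq>\<^sub>s (\<Gamma>, \<Delta>\<^sub>2)"
proof
  assume l: "(mset_set (fset \<Gamma>), \<Delta>\<^sub>1) \<preceq>\<^sub>l (mset_set (fset \<Gamma>), \<Delta>\<^sub>2)"
  \<comment> \<open>\<open>F\<close> is the characteristic formula of the first state; it is tested
    below with empty extensions.\<close>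
  obtain F where F: "entails \<Gamma> \<Delta>\<^sub>1 F"
    "entails \<Gamma> \<Delta>\<^sub>2 F \<Longrightarrow> reaches_realiser (\<Gamma>, \<Delta>\<^sub>1) (\<Gamma>, \<Delta>\<^sub>2)"
    using characteristic_formula by blast
  have "derivable (mset_set (fset \<Gamma>)) \<Delta>\<^sub>1 F"
    using F(1) by (simp add: derivable_iff_entails)
  then have "derivable (mset_set (fset \<Gamma>)) \<Delta>\<^sub>2 F"
    using l[unfolded logical_preorder_def, rule_format, of "{#}" "{#}" F] by simp
  then have "reaches_realiser (\<Gamma>, \<Delta>\<^sub>1) (\<Gamma>, \<Delta>\<^sub>2)"
    using F(2) by (simp add: derivable_iff_entails)
  then show "(\<Gamma>, \<Delta>\<^sub>1) \<preceq>\<^sub>s (\<Gamma>, \<Delta>\<^sub>2)"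
    unfolding sim_preorder_def using simulation_reaches_realiser by blast
next
  assume s: "(\<Gamma>, \<Delta>\<^sub>1) \<preceq>\<^sub>s (\<Gamma>, \<Delta>\<^sub>2)"
  have "derivable (\<Gamma>' + mset_set (fset \<Gamma>)) (\<Delta>' + \<Delta>\<^sub>2) C"
    if "derivable (\<Gamma>' + mset_set (fset \<Gamma>)) (\<Delta>' + \<Delta>\<^sub>1) C" for \<Gamma>' \<Delta>' C
  proof -
    \<comment> \<open>Collapsing the multiset \<Gamma>' to a set turns the extension into a state to
      compose with.\<close>
    define G' where "G' = Abs_fset (set_mset \<Gamma>')"
    have "fset G' = set_mset \<Gamma>'"
      by (simp add: G'_def Abs_fset_inverse)
    then have eq: "set_mset (\<Gamma>' + mset_set (fset \<Gamma>)) = fset (\<Gamma> |\<union>| G')"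
      by auto
    have "(\<Gamma> |\<union>| G', \<Delta>' + \<Delta>\<^sub>1) \<preceq>\<^sub>s (\<Gamma> |\<union>| G', \<Delta>' + \<Delta>\<^sub>2)"
      using sim_preorder_frame[OF s, of "(G', \<Delta>')"] by (simp add: compose_def union_commute)
    then show ?thesis
      using that sim_preorder_entails unfolding derivable_iff_entails[OF eq] by blast
  qed
  then show "(mset_set (fset \<Gamma>), \<Delta>\<^sub>1) \<preceq>\<^sub>l (mset_set (fset \<Gamma>), \<Delta>\<^sub>2)"
    by (simp add: logical_preorder_def)
qed

end
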